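(* Let $Q=\{(k,\ell,m)\in\mathbb Z^3: k\ge0,\ \ell\ge0,\ m\le0\}$. Let $z:Q\to\mathbb C$ be the solution of the cross-ratio system with unitary cross-ratios $q_n=e^{-2i\alpha_n}$, $n=1,2,3$, and of the constraint $$cz_{k,\ell,m}=2k\frac{(z_{k+1,\ell,m}-z_{k,\ell,m})(z_{k,\ell,m}-z_{k-1,\ell,m})}{z_{k+1,\ell,m}-z_{k-1,\ell,m}}+2\ell\frac{(z_{k,\ell+1,m}-z_{k,\ell,m})(z_{k,\ell,m}-z_{k,\ell-1,m})}{z_{k,\ell+1,m}-z_{k,\ell-1,m}}+2m\frac{(z_{k,\ell,m+1}-z_{k,\ell,m})(z_{k,\ell,m}-z_{k,\ell,m-1})}{z_{k,\ell,m+1}-z_{k,\ell,m-1}}$$ with the initial data $$z_{1,0,0}=1,\qquad z_{0,1,0}=e^{i\beta},\qquad z_{0,0,-1}=e^{i\gamma}.$$ Then $z$ determines a circle pattern: for all $(k,\ell,m)\in Q$ with even $k+\ell+m$ the points $z_{k\pm1,\ell,m},z_{k,\ell\pm1,m},z_{k,\ell,m\pm1}$ lie on a circle with the center $z_{k,\ell,m}$.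
   Context: Here $c\in\mathbb C$, $c\neq0$, is the parameter of the constraint, $\beta,\gamma\in\mathbb R$, and $\alpha_1,\alpha_2,\alpha_3$ are real. Cross-ratio: $q(z_1,z_2,z_3,z_4)=\dfrac{(z_2-z_1)(z_4-z_3)}{(z_3-z_2)(z_1-z_4)}$. With constants $\Delta_1,\Delta_2,\Delta_3$, the cross-ratio system on $Q$ is $$q(z_{k,\ell,m},z_{k+1,\ell,m},z_{k+1,\ell,m-1},z_{k,\ell,m-1})=\tfrac{\Delta_1}{\Delta_3}=q_2,\quad q(z_{k,\ell,m},z_{k,\ell,m+1},z_{k,\ell-1,m+1},z_{k,\ell-1,m})=\tfrac{\Delta_3}{\Delta_2}=q_1,$$ $$q(z_{k,\ell,m},z_{k,\ell+1,m},z_{k-1,\ell+1,m},z_{k-1,\ell,m})=\tfrac{\Delta_2}{\Delta_1}=q_3$$ for all quadrilaterals with indices in $Q$ (so $q_1q_2q_3=1$). The constraint is imposed at the points of $Q$, a term whose coefficient $k$, $\ell$ or $m$ vanishes being absent (in particular $z_{0,0,0}=0$); the solution is uniquely determined by the three initial values. In the conclusion, only points with indices in $Q$ are meant.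
   Formalization: The parameter c is assumed real (and nonzero): for non-real c and generic angles the points around z_{2,0,0} do not lie on a circle with that center. The denominators of the constraint terms that are present are assumed nonzero. *)

theory Defs
  imports "HOL-Analysis.Analysis"
begin

definition Q :: "(int \<times> int \<times> int) set" where
  "Q = {(k, l, m). k \<ge> 0 \<and> l \<ge> 0 \<and> m \<le> 0}"

definition cross_ratio :: "complex \<Rightarrow> complex \<Rightarrow> complex \<Rightarrow> complex \<Rightarrow> complex" where
  "cross_ratio z1 z2 z3 z4 = ((z2 - z1) * (z4 - z3)) / ((z3 - z2) * (z1 - z4))"

text \<open>Lattice maps are total functions on the integer lattice; only their values on \<^term>\<open>Q\<close>
  are ever constrained or used.  For nonzero constants \<open>\<Delta>1, \<Delta>2, \<Delta>3\<close> the prescribed values are nonzero,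
  so by \<open>x / 0 = 0\<close> the equations below force the denominators of the cross-ratios to be nonzero
  (indeed, neighbouring points to be distinct).\<close>

definition cross_ratio_system ::
    "complex \<Rightarrow> complex \<Rightarrow> complex \<Rightarrow> (int \<times> int \<times> int \<Rightarrow> complex) \<Rightarrow> bool" where
  "cross_ratio_system \<Delta>1 \<Delta>2 \<Delta>3 z \<longleftrightarrow>
    (\<forall>k l m. {(k, l, m), (k+1, l, m), (k+1, l, m-1), (k, l, m-1)} \<subseteq> Q \<longrightarrow>
       cross_ratio (z (k, l, m)) (z (k+1, l, m)) (z (k+1, l, m-1)) (z (k, l, m-1)) = \<Delta>1 / \<Delta>3) \<and>
    (\<forall>k l m. {(k, l, m), (k, l, m+1), (k, l-1, m+1), (k, l-1, m)} \<subseteq> Q \<longrightarrow>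
       cross_ratio (z (k, l, m)) (z (k, l, m+1)) (z (k, l-1, m+1)) (z (k, l-1, m)) = \<Delta>3 / \<Delta>2) \<and>
    (\<forall>k l m. {(k, l, m), (k, l+1, m), (k-1, l+1, m), (k-1, l, m)} \<subseteq> Q \<longrightarrow>
       cross_ratio (z (k, l, m)) (z (k, l+1, m)) (z (k-1, l+1, m)) (z (k-1, l, m)) = \<Delta>2 / \<Delta>1)"

text \<open>The summand with integer coefficient \<open>n\<close> of the constraint, for three consecutive points
  \<open>x, y, w\<close> on a coordinate line.  For \<open>n = 0\<close> it vanishes whatever the points are, so points
  outside \<^term>\<open>Q\<close> do not matter.\<close>

definition constraint_term :: "int \<Rightarrow> complex \<Rightarrow> complex \<Rightarrow> complex \<Rightarrow> complex" where
  "constraint_term n x y w = 2 * of_int n * (((w - y) * (y - x)) / (w - x))"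

text \<open>The three inequations say that the denominators of the terms actually present are nonzero;
  without them \<open>x / 0 = 0\<close> would admit spurious solutions.\<close>

definition satisfies_constraint :: "complex \<Rightarrow> (int \<times> int \<times> int \<Rightarrow> complex) \<Rightarrow> bool" where
  "satisfies_constraint c z \<longleftrightarrow> (\<forall>k l m. (k, l, m) \<in> Q \<longrightarrow>
     (k \<noteq> 0 \<longrightarrow> z (k+1, l, m) \<noteq> z (k-1, l, m)) \<and>
     (l \<noteq> 0 \<longrightarrow> z (k, l+1, m) \<noteq> z (k, l-1, m)) \<and>
     (m \<noteq> 0 \<longrightarrow> z (k, l, m+1) \<noteq> z (k, l, m-1)) \<and>
     c * z (k, l, m) =
         constraint_term k (z (k-1, l, m)) (z (k, l, m)) (z (k+1, l, m))
       + constraint_term l (z (k, l-1, m)) (z (k, l, m)) (z (k, l+1, m))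
       + constraint_term m (z (k, l, m-1)) (z (k, l, m)) (z (k, l, m+1)))"

definition lattice_neighbours :: "int \<Rightarrow> int \<Rightarrow> int \<Rightarrow> (int \<times> int \<times> int) set" where
  "lattice_neighbours k l m =
     {(k+1, l, m), (k-1, l, m), (k, l+1, m), (k, l-1, m), (k, l, m+1), (k, l, m-1)}"

end

theory Submission
  imports Defs
begin

text \<open>
  Reflecting the third coordinate turns the octant into the lattice of points
  \<open>p :: 3 \<Rightarrow> nat\<close>, and then all quadrilaterals obey one rule: the cross-ratio of
  \<open>f p, f (p + e\<^sub>i), f (p + e\<^sub>i + e\<^sub>j), f (p + e\<^sub>j)\<close> is \<open>D\<^sub>i / D\<^sub>j\<close>, where the constants have a
  common modulus.  In a circle pattern the even points are centres and the odd points are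
  intersection points of circles.  At a centre all edges have the same length; at an intersection
  point the angles between the edges are those prescribed by the constants, that is, the quotient
  \<open>e / (D\<^sub>i * cnj e)\<close> is the same for all edges \<open>e\<close>, where \<open>i\<close> is the direction of \<open>e\<close>.  So at every
  point there is a quantity, \<open>edge_invariant\<close>, that should agree on all edges; the point is then
  called balanced.

  If \<open>D\<^sub>i \<noteq> D\<^sub>j\<close>, a quadrilateral whose two edges at one corner agree is a kite, and then its edges
  agree at every corner (\<open>kite_propagation\<close>).  Hence balance spreads from the origin by induction on
  the sum of the coordinates (\<open>balanced_generic\<close>): at a point that is not on an axis, any two edges are
  linked by quadrilaterals that start at lower points.  On an axis the edge leading
  forwards and the edge leading backwards are not linked in this way.  There the constraint contains a
  single term; the resulting recursion shows that the axis is straight, because \<open>c\<close> is real,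
  and that at its even points the two edges have the same length (\<open>axis_edge_invariant\<close>).

  If \<open>D\<^sub>i = D\<^sub>j\<close>, every quadrilateral in the directions \<open>i\<close> and \<open>j\<close> has a pair of coinciding opposite
  corners.  Points two steps apart on a coordinate line are distinct by the constraint, and this
  forces the same alternative on the whole lattice (\<open>plane_dichotomy\<close>).  If
  \<open>f (p + e\<^sub>i + e\<^sub>j) = f p\<close> throughout, each of these quadrilaterals runs to and fro along two segments,
  and balance propagates trivially.  If \<open>f (p + e\<^sub>i) = f (p + e\<^sub>j)\<close> throughout, the direction \<open>j\<close> adds no new points
  and can be dropped (\<open>balanced_merge\<close>).
\<close>

section \<open>Lattice points with natural coordinates\<close>

definition step :: "'d \<Rightarrow> ('d \<Rightarrow> nat) \<Rightarrow> 'd \<Rightarrow> nat" where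
  "step i p = p(i := Suc (p i))"

definition level :: "('d::finite \<Rightarrow> nat) \<Rightarrow> nat" where
  "level p = (\<Sum>i\<in>UNIV. p i)"

lemma step_commute: "step i (step j p) = step j (step i p)"
  by (auto simp: step_def fun_eq_iff)

lemma level_step [simp]: "level (step i p) = Suc (level p)"
proof -
  have "level (step i p) = (\<Sum>j\<in>UNIV. p j + (if j = i then 1 else 0))"
    unfolding level_def step_def by (rule sum.cong) auto
  then show ?thesis by (simp add: sum.distrib level_def)
qed

lemma step_inject [simp]: "step i p = step i q \<longleftrightarrow> p = q"
proof
  assume eq: "step i p = step i q"
  have "p d = q d" for d
    using fun_cong[OF eq, of d] by (cases "d = i") (simp_all add: step_def)
  then show "p = q" by blast
qed simp

lemma step_down:
  assumes "0 < p i"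
  obtains q where "p = step i q"
proof -
  have "p = step i (p(i := p i - 1))"
    using assms by (auto simp: step_def)
  then show ?thesis using that by blast
qed

text \<open>Two backward edges at a point are the far sides of a quadrilateral, whose base point is the
  \<open>r\<close> obtained here.\<close>

lemma step_join:
  assumes "i \<noteq> j" "step i p = step j q"
  obtains r where "p = step j r" "q = step i r"
proof -
  have "0 < p j"
    using fun_cong[OF assms(2), of j] assms(1) by (simp add: step_def)
  then obtain r where r: "p = step j r" by (rule step_down)
  have "step j (step i r) = step j q"
    using assms(2) r by (simp add: step_commute)
  then show ?thesis using that r by simp
qed

lemma step_induct [case_names zero step]:
  fixes p :: "'d::finite \<Rightarrow> nat"
  assumes zero: "P (\<lambda>_. 0)" and step: "\<And>i q. P q \<Longrightarrow> P (step i q)"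
  shows "P p"
proof (induction "level p" arbitrary: p rule: less_induct)
  case less
  show ?case
  proof (cases "p = (\<lambda>_. 0)")
    case True
    then show ?thesis using zero by simp
  next
    case False
    then obtain i where "0 < p i" by auto
    then obtain q where "p = step i q" by (rule step_down)
    then show ?thesis using less step by simp
  qed
qed

section \<open>Kites\<close>

text \<open>The quantity shared by all edges at a vertex of a circle pattern: the radius at a
  centre and, at an intersection point, the square of the direction of the edge divided
  by the constant \<open>d\<close> belonging to that edge.  It does not depend on the orientation of the edge,
  so forward and backward edges can be compared.\<close>

definition edge_invariant :: "bool \<Rightarrow> complex \<Rightarrow> complex \<Rightarrow> complex" where
  "edge_invariant centre d e = (if centre then of_real (norm e) else e / (d * cnj e))"

lemma edge_invariant_minus [simp]: "edge_invariant s d (- e) = edge_invariant s d e"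
  by (simp add: edge_invariant_def)

text \<open>In the lemmas of this section a quadrilateral is given by its edges: \<open>a\<close> and \<open>b\<close> start at one
  corner, \<open>a'\<close> is the edge opposite to \<open>a\<close>, and \<open>b'\<close> is the edge opposite to \<open>b\<close>.

  If the two edges at each of two opposite corners have equal lengths, both corners lie on the
  perpendicular bisector of the other diagonal.  The reflection in this bisector maps \<open>a\<close> to \<open>b\<close> and
  \<open>b'\<close> to \<open>a'\<close>; it has the form \<open>w \<mapsto> u * cnj w\<close>, and the two equations result from eliminating \<open>u\<close>
  from \<open>b = u * cnj a\<close>, \<open>a = u * cnj b\<close>, \<open>a' = u * cnj b'\<close> and \<open>b' = u * cnj a'\<close>.\<close>

lemma equal_lengths_reflect:
  fixes a b a' b' :: complex
  assumes closed: "a + b' = b + a'" and "a \<noteq> b"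
    and len: "norm a = norm b" "norm a' = norm b'"
  shows "b * cnj b' = a' * cnj a" "b * cnj a' = b' * cnj a"
proof -
  have l: "a * cnj a = b * cnj b" "a' * cnj a' = b' * cnj b'"
    using len by (simp_all add: complex_norm_square[symmetric])
  have d: "b' - a' = b - a" using closed by (simp add: algebra_simps)
  have d': "cnj b' - cnj a' = cnj b - cnj a" using arg_cong[OF d, of cnj] by simp
  \<comment> \<open>The reflection has \<open>u = - (b - a) / cnj (b - a)\<close>, with \<open>b - a\<close> along the diagonal.\<close>
  have e1: "cnj a * (b - a) = - (b * (cnj b - cnj a))"
    using l by (simp add: algebra_simps)
  have e2: "cnj a' * (b - a) = - (b' * (cnj b - cnj a))"
    unfolding d[symmetric] d'[symmetric] using l by (simp add: algebra_simps)
  have e3: "cnj b' * (b - a) = - (a' * (cnj b - cnj a))"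
    unfolding d[symmetric] d'[symmetric] using l by (simp add: algebra_simps)
  have ne: "b - a \<noteq> 0" using \<open>a \<noteq> b\<close> by simp
  have "(b * cnj b') * (b - a) = (a' * cnj a) * (b - a)"
    using e1 e3 by algebra
  then show "b * cnj b' = a' * cnj a" using ne by simp
  have "(b * cnj a') * (b - a) = (b' * cnj a) * (b - a)"
    using e1 e2 by algebra
  then show "b * cnj a' = b' * cnj a" using ne by simp
qed

text \<open>Since \<open>d1\<close> and \<open>d2\<close> have the same modulus, the cross-ratio is unimodular, so equal lengths at one
  corner give equal lengths at the opposite corner.  The quadrilateral is then a kite, and the
  argument of its cross-ratio gives the angles at the other two corners.\<close>

lemma kite_from_centre:
  fixes a b a' b' d1 d2 :: complex
  assumes nz: "a \<noteq> 0" "b \<noteq> 0" "a' \<noteq> 0" "b' \<noteq> 0" "d1 \<noteq> 0" "d2 \<noteq> 0"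
    and nd: "norm d1 = norm d2"
    and closed: "a + b' = b + a'" and cr: "a * a' * d2 = d1 * b' * b"
    and "d1 \<noteq> d2" and len: "norm a = norm b"
  shows "norm a' = norm b'" "a * cnj b' * d2 = cnj a * b' * d1" "b * cnj a' * d1 = cnj b * a' * d2"
proof -
  have "norm a * norm a' * norm d2 = norm d1 * norm b' * norm b"
    using arg_cong[OF cr, of norm] by (simp add: norm_mult)
  then show len': "norm a' = norm b'" using nz nd len by simp
  have "a \<noteq> b"
  proof
    assume "a = b"
    with closed have "a' = b'" by simp
    with cr \<open>a = b\<close> nz have "d1 = d2" by simp
    with \<open>d1 \<noteq> d2\<close> show False ..
  qed
  note r = equal_lengths_reflect[OF closed this len len']
  have "(a * cnj b' * d2) * (b * a') = (cnj a * b' * d1) * (b * a')"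
    using cr r(1) by algebra
  then show "a * cnj b' * d2 = cnj a * b' * d1" using nz by simp
  have r': "cnj b * b' = cnj a' * a" using arg_cong[OF r(1), of cnj] by simp
  have "(b * cnj a' * d1) * (a * b') = (cnj b * a' * d2) * (a * b')"
    using cr r' by algebra
  then show "b * cnj a' * d1 = cnj b * a' * d2" using nz by simp
qed

text \<open>Conversely, the prescribed angle between \<open>a\<close> and \<open>b'\<close> makes the quadrilateral a kite: with \<open>s\<close> the
  diagonal \<open>a + b'\<close>, the hypotheses combine to \<open>b * cnj s = s * cnj a\<close>, which says that \<open>b\<close> is the
  reflection of \<open>a\<close> in \<open>s\<close>.  A vanishing diagonal would force \<open>d1 = d2\<close>.\<close>

lemma kite_from_intersection:
  fixes a b a' b' d1 d2 :: complex
  assumes nz: "a \<noteq> 0" "b \<noteq> 0" "a' \<noteq> 0" "b' \<noteq> 0" "d1 \<noteq> 0" "d2 \<noteq> 0"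
    and closed: "a + b' = b + a'" and cr: "a * a' * d2 = d1 * b' * b"
    and "d1 \<noteq> d2" and ang: "a * cnj b' * d2 = cnj a * b' * d1"
  shows "norm a = norm b"
proof -
  have ne: "a + b' \<noteq> 0"
  proof
    assume "a + b' = 0"
    then have "b' = - a" "a' = - b" using closed by (auto simp: add_eq_0_iff)
    with cr nz \<open>d1 \<noteq> d2\<close> show False by simp
  qed
  have "(b * cnj b') * (a * d2 * b') = (a' * cnj a) * (a * d2 * b')"
    using cr ang by algebra
  then have "b * cnj b' = a' * cnj a" using nz by simp
  then have "b * cnj (a + b') = (b + a') * cnj a"
    by (simp add: distrib_left distrib_right)
  then have "b * cnj (a + b') = (a + b') * cnj a"
    unfolding closed .
  then have "norm b * norm (a + b') = norm (a + b') * norm a"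
    by (metis complex_mod_cnj norm_mult)
  then show ?thesis using ne by simp
qed

text \<open>In the second alternative of \<open>gen\<close> the base point coincides with the opposite corner, so that
  the quadrilateral runs to and fro along two segments: \<open>b' = - a\<close> and \<open>a' = - b\<close>.\<close>

lemma kite_propagation:
  fixes a b a' b' d1 d2 :: complex
  assumes nz: "a \<noteq> 0" "b \<noteq> 0" "a' \<noteq> 0" "b' \<noteq> 0" "d1 \<noteq> 0" "d2 \<noteq> 0"
    and nd: "norm d1 = norm d2"
    and closed: "a + b' = b + a'" and cr: "a * a' * d2 = d1 * b' * b"
    and gen: "d1 \<noteq> d2 \<or> a + b' = 0"
    and inv: "edge_invariant s d1 a = edge_invariant s d2 b"
  shows "edge_invariant (\<not> s) d1 a = edge_invariant (\<not> s) d2 b'"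
    and "edge_invariant s d1 a' = edge_invariant s d2 b'"
proof -
  have "edge_invariant (\<not> s) d1 a = edge_invariant (\<not> s) d2 b' \<and>
        edge_invariant s d1 a' = edge_invariant s d2 b'"
  proof (cases "d1 = d2")
    case True
    with gen have "a + b' = 0" by simp
    then have "b' = - a" "a' = - b" using closed by (auto simp: add_eq_0_iff)
    with inv True show ?thesis by simp
  next
    case ne: False
    show ?thesis
    proof (cases s)
      case True
      with inv have len: "norm a = norm b" by (simp add: edge_invariant_def)
      note k = kite_from_centre[OF nz nd closed cr ne len]
      show ?thesis using True k nz by (simp add: edge_invariant_def field_simps)
    next
      case False
      have ang: "a * cnj b * d2 = cnj a * b * d1"
        using inv False nz by (simp add: edge_invariant_def field_simps)
      \<comment> \<open>The centres are now the ends of \<open>a\<close> and \<open>b\<close>, so the quadrilateral is read from the end of \<open>a\<close>.\<close>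
      have nz1: "- a \<noteq> 0" "b' \<noteq> 0" "- a' \<noteq> 0" "b \<noteq> 0" using nz by auto
      have cl1: "- a + b = b' + - a'" using closed by (simp add: algebra_simps)
      have cr1: "- a * - a' * d2 = d1 * b * b'" using cr by simp
      have len: "norm (- a) = norm b'"
        by (rule kite_from_intersection[OF nz1 nz(5,6) cl1 cr1 ne]) (use ang in simp)
      note k = kite_from_centre[OF nz1 nz(5,6) nd cl1 cr1 ne len]
      show ?thesis using False k nz len by (simp add: edge_invariant_def field_simps)
    qed
  qed
  then show "edge_invariant (\<not> s) d1 a = edge_invariant (\<not> s) d2 b'"
    and "edge_invariant s d1 a' = edge_invariant s d2 b'" by auto
qed

section \<open>Cross-ratio systems of arbitrary dimension\<close>

text \<open>Directions form an arbitrary finite type, so that the directions play symmetric roles and an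
  argument for one coordinate plane covers all of them.\<close>

locale cross_ratio_lattice =
  fixes D :: "'d::finite \<Rightarrow> complex" and f :: "('d \<Rightarrow> nat) \<Rightarrow> complex"
  assumes D_nonzero: "D i \<noteq> 0" and norm_D: "norm (D i) = norm (D j)"
    and edge_nonzero: "f (step i p) \<noteq> f p"
    and two_steps_distinct: "f (step i (step i p)) \<noteq> f p"
    and cross_ratio_eq: "i \<noteq> j \<Longrightarrow>
      (f (step i p) - f p) * (f (step i (step j p)) - f (step j p)) * D j =
      D i * (f (step i (step j p)) - f (step i p)) * (f (step j p) - f p)"
begin

lemma quad_dichotomy:
  assumes "i \<noteq> j" "D i = D j"
  shows "f (step i p) = f (step j p) \<or> f (step i (step j p)) = f p"
proof -
  have "(f (step i p) - f (step j p)) * (f (step i (step j p)) - f p) * D i = 0"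
    using cross_ratio_eq[OF assms(1), of p] assms(2) by algebra
  then show ?thesis using D_nonzero by auto
qed

text \<open>The cross-ratio equation determines a corner from the other three by a
  Moebius transformation.  As \<open>i\<close> and \<open>j\<close> carry the same constant, the quadrilaterals in the
  directions \<open>i, h\<close> and \<open>j, h\<close> obey the same equation, so they agree in all corners if they agree in
  three.\<close>

lemma fourth_vertex_unique:
  assumes "i \<noteq> h" "j \<noteq> h" "D i = D j" "D h \<noteq> D i"
  shows "f (step i p) = f (step j p) \<longleftrightarrow> f (step i (step h p)) = f (step j (step h p))"
proof
  define a c where "a = f (step i p) - f p" and "c = f (step h p) - f p"
  have nz: "a \<noteq> 0" "c \<noteq> 0" using edge_nonzero by (auto simp: a_def c_def)
  note qi = cross_ratio_eq[OF assms(1), of p]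
  note qj = cross_ratio_eq[OF assms(2), of p]
  {
    assume eq: "f (step i p) = f (step j p)"
    have *: "(a * D h - D i * c) * (f (step i (step h p)) - f (step j (step h p))) = 0"
      using qi qj eq assms(3) unfolding a_def c_def by algebra
    \<comment> \<open>The equation is linear in the unknown corner, with this leading coefficient.\<close>
    have "a * D h - D i * c \<noteq> 0"
    proof
      assume z: "a * D h - D i * c = 0"
      then have "a * D h * (f (step h p) - f (step i p)) = 0"
        using qi unfolding a_def c_def by algebra
      then have "f (step h p) = f (step i p)" using nz D_nonzero by auto
      then show False using z nz assms(4) by (simp add: a_def c_def)
    qed
    with * show "f (step i (step h p)) = f (step j (step h p))" by simp
  }
  {
    assume eq: "f (step i (step h p)) = f (step j (step h p))"
    let ?x = "f (step i (step h p))"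
    have *: "(D h * (?x - f (step h p)) + D i * c) * (f (step i p) - f (step j p)) = 0"
      using qi qj eq assms(3) unfolding a_def c_def by algebra
    have "D h * (?x - f (step h p)) + D i * c \<noteq> 0"
    proof
      assume z: "D h * (?x - f (step h p)) + D i * c = 0"
      then have "D i * c * (?x - f p) = 0"
        using qi unfolding a_def c_def by algebra
      then have "?x = f p" using nz D_nonzero by auto
      then have "(D i - D h) * c = 0" using z by (simp add: c_def algebra_simps)
      then show False using nz assms(4) by simp
    qed
    with * show "f (step i p) = f (step j p)" by simp
  }
qed

text \<open>The other alternative of \<open>quad_dichotomy\<close> at the neighbouring quadrilateral would identify two
  points that are two steps apart on a coordinate line.\<close>

lemma coincidence_step_in_plane:
  assumes "i \<noteq> j" "D i = D j"
  shows "f (step i (step i p)) = f (step j (step i p)) \<longleftrightarrow> f (step i p) = f (step j p)"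
proof
  assume eq: "f (step i (step i p)) = f (step j (step i p))"
  then show "f (step i p) = f (step j p)"
    using quad_dichotomy[OF assms, of p] two_steps_distinct[of i p]
    by (metis step_commute)
next
  assume "f (step i p) = f (step j p)"
  then show "f (step i (step i p)) = f (step j (step i p))"
    using quad_dichotomy[OF assms, of "step i p"] two_steps_distinct[of i "step j p"]
    by (metis step_commute)
qed

text \<open>When all three constants agree, a corner of a quadrilateral need not be determined by the other
  three, and \<open>fourth_vertex_unique\<close> has no counterpart.  The distinctness of points two steps apart
  takes its place: if \<open>f (p + e\<^sub>i)\<close> and \<open>f (p + e\<^sub>j)\<close> are distinct while their translates by \<open>e\<^sub>h\<close>
  coincide, then \<open>f (p + e\<^sub>i + e\<^sub>j + e\<^sub>h)\<close> has to be equal to both of them.\<close>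

lemma coincidence_step_across:
  assumes "i \<noteq> j" "D i = D j" "h \<noteq> i" "h \<noteq> j" "D h = D i"
  shows "f (step i (step h p)) = f (step j (step h p)) \<longleftrightarrow> f (step i p) = f (step j p)"
proof
  note qd = quad_dichotomy
  assume B: "f (step i p) = f (step j p)"
  show "f (step i (step h p)) = f (step j (step h p))"
  proof (cases "f (step i p) = f (step h p)")
    case False
    then show ?thesis
      using qd[of i h p] qd[of j h p] assms B by metis
  next
    case True
    have "f (step i (step i p)) = f (step j (step i p))" 
         "f (step i (step i p)) = f (step h (step i p))" 
         "f (step j (step j p)) = f (step i (step j p))" 
         "f (step j (step j p)) = f (step h (step j p))" 
      using True B assms coincidence_step_in_plane by metis+
    then show ?thesis by (metis step_commute)
  qed
next
  assume B: "f (step i (step h p)) = f (step j (step h p))"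
  \<comment> \<open>As \<open>f (step i p)\<close> and \<open>f (step j p)\<close> differ, one of them differs from \<open>f (step h p)\<close>; by symmetry
    it may be taken to be \<open>f (step i p)\<close>.\<close>
  have wlog: False
    if ij: "i \<noteq> j" "D i = D j" "h \<noteq> i" "h \<noteq> j" "D h = D i"
      and B: "f (step i (step h p)) = f (step j (step h p))"
      and nB: "f (step i p) \<noteq> f (step j p)" and ih: "f (step i p) \<noteq> f (step h p)" for i j
  proof -
    have A: "f (step i (step j q)) = f q" if "f (step i q) \<noteq> f (step j q)" for q
      using quad_dichotomy[OF ij(1,2)] that by blast
    have ih': "f (step i (step h p)) = f p"
      using quad_dichotomy[of i h p] ij ih by auto
    have jh': "f (step j (step h p)) = f p" using B ih' by simp
    have ij': "f (step i (step j p)) = f p" using A nB by simp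
    have ni: "f (step i (step i p)) \<noteq> f (step j (step i p))"
      using coincidence_step_in_plane[OF ij(1,2)] nB by simp
    have nj: "f (step i (step j p)) \<noteq> f (step j (step j p))"
      using coincidence_step_in_plane[of j i p] ij nB by auto
    have "f (step i (step h (step i (step j p)))) \<noteq> f (step i (step j p))"
      using two_steps_distinct[of i "step j (step h p)"] jh' ij' by (metis step_commute)
    then have "f (step i (step i (step j p))) = f (step h (step i (step j p)))"
      using quad_dichotomy[of i h "step i (step j p)"] ij by auto
    moreover have "f (step i (step i (step j p))) = f (step i p)"
      using A[OF ni] by (metis step_commute)
    moreover have "f (step j (step h (step i (step j p)))) \<noteq> f (step i (step j p))"
      using two_steps_distinct[of j "step i (step h p)"] ih' ij' by (metis step_commute)
    then have "f (step j (step i (step j p))) = f (step h (step i (step j p)))"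
      using quad_dichotomy[of j h "step i (step j p)"] ij by auto
    moreover have "f (step j (step i (step j p))) = f (step j p)"
      using A[OF nj] by (metis step_commute)
    ultimately show False using nB by simp
  qed
  show "f (step i p) = f (step j p)"
  proof (rule ccontr)
    assume nB: "f (step i p) \<noteq> f (step j p)"
    then consider "f (step i p) \<noteq> f (step h p)" | "f (step j p) \<noteq> f (step h p)" by metis
    then show False
    proof cases
      case 1
      then show False using wlog[of i j] assms B nB by blast
    next
      case 2
      then show False using wlog[of j i] assms B nB by simp
    qed
  qed
qed

lemma plane_dichotomy:
  assumes "i \<noteq> j" "D i = D j"
  shows "(\<forall>p. f (step i p) = f (step j p)) \<or> (\<forall>p. f (step i (step j p)) = f p)"
proof -
  have invariant: "f (step i (step h p)) = f (step j (step h p)) \<longleftrightarrow> f (step i p) = f (step j p)" for h p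
  proof -
    consider "h = i" | "h = j" | "h \<noteq> i" "h \<noteq> j" "D h = D i" | "h \<noteq> i" "h \<noteq> j" "D h \<noteq> D i" by blast
    then show ?thesis
    proof cases
      case 1
      then show ?thesis using coincidence_step_in_plane[OF assms] by simp
    next
      case 2
      then show ?thesis using coincidence_step_in_plane[of j i p] assms by auto
    next
      case 3
      then show ?thesis using coincidence_step_across[OF assms] by simp
    next
      case 4
      then show ?thesis using fourth_vertex_unique[of i h j p] assms by simp
    qed
  qed
  have "f (step i p) = f (step j p) \<longleftrightarrow> f (step i (\<lambda>_. 0)) = f (step j (\<lambda>_. 0))" for p
    by (induction p rule: step_induct) (simp_all add: invariant)
  then show ?thesis using quad_dichotomy[OF assms] by blast
qed

text \<open>An edge is recorded together with the constant of its direction, not with the direction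
  itself: merging two directions with the same constant then preserves the set of edges.
  Only the directions in \<open>S\<close> count.\<close>

definition edges :: "'d set \<Rightarrow> ('d \<Rightarrow> nat) \<Rightarrow> (complex \<times> complex) set" where
  "edges S p = {(D i, e) | i e. i \<in> S \<and>
     (e = f (step i p) - f p \<or> (\<exists>q. p = step i q \<and> e = f p - f q))}"

definition balanced :: "'d set \<Rightarrow> ('d \<Rightarrow> nat) \<Rightarrow> bool" where
  "balanced S p \<longleftrightarrow> (\<forall>(d, e) \<in> edges S p. \<forall>(d', e') \<in> edges S p.
     edge_invariant (even (level p)) d e = edge_invariant (even (level p)) d' e')"

lemma forward_edge: "i \<in> S \<Longrightarrow> (D i, f (step i p) - f p) \<in> edges S p"
  by (auto simp: edges_def)

lemma backward_edge: "i \<in> S \<Longrightarrow> (D i, f (step i p) - f p) \<in> edges S (step i p)"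
  by (auto simp: edges_def)

lemma balancedD:
  "\<lbrakk>balanced S p; (d, e) \<in> edges S p; (d', e') \<in> edges S p\<rbrakk> \<Longrightarrow>
     edge_invariant (even (level p)) d e = edge_invariant (even (level p)) d' e'"
  by (auto simp: balanced_def)

text \<open>If the base point of a quadrilateral is balanced, the two edges agree at the neighbouring corner and at
  the opposite corner; the neighbouring corner has the other parity.\<close>

lemma quad_propagation:
  assumes "i \<noteq> j" "i \<in> S" "j \<in> S" "balanced S p"
    and gen: "D i \<noteq> D j \<or> (\<forall>p. f (step i (step j p)) = f p)"
  shows "edge_invariant (odd (level p)) (D i) (f (step i p) - f p) =
         edge_invariant (odd (level p)) (D j) (f (step j (step i p)) - f (step i p))"
    and "edge_invariant (even (level p)) (D i) (f (step i (step j p)) - f (step j p)) =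
         edge_invariant (even (level p)) (D j) (f (step j (step i p)) - f (step i p))"
proof -
  define a where "a = f (step i p) - f p"
  define b where "b = f (step j p) - f p"
  define a' where "a' = f (step i (step j p)) - f (step j p)"
  define b' where "b' = f (step j (step i p)) - f (step i p)"
  have nz: "a \<noteq> 0" "b \<noteq> 0" "a' \<noteq> 0" "b' \<noteq> 0"
    using edge_nonzero by (auto simp: a_def b_def a'_def b'_def)
  have closed: "a + b' = b + a'"
    by (simp add: a_def b_def a'_def b'_def step_commute[of i j])
  have cr: "a * a' * D j = D i * b' * b"
    using cross_ratio_eq[OF assms(1), of p]
    by (simp add: a_def b_def a'_def b'_def step_commute[of i j])
  have gen': "D i \<noteq> D j \<or> a + b' = 0"
    using gen by (auto simp: a_def b'_def step_commute[of i j])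
  have inv: "edge_invariant (even (level p)) (D i) a = edge_invariant (even (level p)) (D j) b"
    unfolding a_def b_def using assms by (intro balancedD[of S] forward_edge)
  note k = kite_propagation[OF nz D_nonzero D_nonzero norm_D closed cr gen' inv]
  show "edge_invariant (odd (level p)) (D i) (f (step i p) - f p) =
        edge_invariant (odd (level p)) (D j) (f (step j (step i p)) - f (step i p))"
    using k(1) unfolding a_def b'_def .
  show "edge_invariant (even (level p)) (D i) (f (step i (step j p)) - f (step j p)) =
        edge_invariant (even (level p)) (D j) (f (step j (step i p)) - f (step i p))"
    using k(2) unfolding a'_def b'_def .
qed

end

section \<open>Balance of all lattice points\<close>

text \<open>The assumption on the axes compares the forward and the backward edge at \<open>step i p\<close>.\<close>

locale cross_ratio_lattice_axes = cross_ratio_lattice D f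
  for D :: "'d::finite \<Rightarrow> complex" and f :: "('d \<Rightarrow> nat) \<Rightarrow> complex" +
  assumes initial: "norm (f (step i (\<lambda>_. 0)) - f (\<lambda>_. 0)) = norm (f (step j (\<lambda>_. 0)) - f (\<lambda>_. 0))"
    and axis: "(\<And>d. d \<noteq> i \<Longrightarrow> p d = 0) \<Longrightarrow>
      edge_invariant (odd (level p)) (D i) (f (step i (step i p)) - f (step i p)) =
      edge_invariant (odd (level p)) (D i) (f (step i p) - f p)"
begin

text \<open>Induction on the level.  At a point other than the origin, two backward edges are linked by the
  quadrilateral based two levels below, and a forward edge is linked to a backward edge of a different direction by a
  quadrilateral based one level below.  The forward and the backward edge of the same direction \<open>i\<close> are both
  linked to a backward edge of another direction, unless the point lies on the axis of \<open>i\<close>.\<close>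

lemma balanced_generic:
  assumes gen: "\<And>i j. \<lbrakk>i \<in> S; j \<in> S; i \<noteq> j\<rbrakk> \<Longrightarrow> D i \<noteq> D j \<or> (\<forall>p. f (step i (step j p)) = f p)"
    and "\<And>d. d \<notin> S \<Longrightarrow> p d = 0"
  shows "balanced S p"
  using assms(2)
proof (induction "level p" arbitrary: p rule: less_induct)
  case less
  note IH = less.hyps
  show ?case
  proof (cases "p = (\<lambda>_. 0)")
    case True
    have "p \<noteq> step i q" for i q
      using True by (metis nat.distinct(1) step_def fun_upd_same)
    then have "\<exists>i. e = f (step i (\<lambda>_. 0)) - f (\<lambda>_. 0)" if "(d, e) \<in> edges S p" for d e
      using that True by (auto simp: edges_def)
    then have "norm e = norm e'" if "(d, e) \<in> edges S p" "(d', e') \<in> edges S p" for d e d' e'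
      using that initial by metis
    moreover have "level p = 0" using True by (simp add: level_def)
    ultimately show ?thesis
      unfolding balanced_def edge_invariant_def by auto
  next
    case False
    have down: "i \<in> S" "balanced S q" "level q < level p" if "p = step i q" for i q
    proof -
      have "p i \<noteq> 0" using that by (simp add: step_def)
      then show "i \<in> S" using less.prems[of i] by (cases "i \<in> S") simp_all
      show "level q < level p" using that by simp
      moreover have "q d = 0" if "d \<notin> S" for d
        using less.prems[OF that] \<open>p = step i q\<close> by (simp add: step_def split: if_splits)
      ultimately show "balanced S q" by (rule IH)
    qed
    let ?I = "edge_invariant (even (level p))"
    have forward: "?I (D i) (f p - f q) = ?I (D j) (f (step j p) - f p)"
      if "p = step i q" "j \<in> S" "j \<noteq> i" for i j q
    proof -
      note d = down[OF that(1)]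
      have "D i \<noteq> D j \<or> (\<forall>p. f (step i (step j p)) = f p)"
        using gen[OF d(1) that(2)] that(3) by blast
      from quad_propagation(1)[OF that(3)[symmetric] d(1) that(2) d(2) this] show ?thesis
        by (simp add: that(1))
    qed
    have backward: "?I (D i) (f p - f q) = ?I (D j) (f p - f q')"
      if q: "p = step i q" and q': "p = step j q'" for i j q q'
    proof (cases "i = j")
      case True
      then show ?thesis using q q' by simp
    next
      case ne: False
      obtain r where r: "q = step j r" "q' = step i r"
        using step_join[OF ne] q q' by metis
      have "r d = 0" if "d \<notin> S" for d
        using less.prems[OF that] q r by (simp add: step_def split: if_splits)
      then have bal: "balanced S r" using q r by (intro IH) auto
      have "D i \<noteq> D j \<or> (\<forall>p. f (step i (step j p)) = f p)"
        using gen[OF down(1)[OF q] down(1)[OF q'] ne] .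
      from quad_propagation(2)[OF ne down(1)[OF q] down(1)[OF q'] bal this]
      have "?I (D i) (f (step i (step j r)) - f (step j r)) =
            ?I (D j) (f (step j (step i r)) - f (step i r))"
        by (simp add: q r)
      moreover have "step i (step j r) = p" "step j (step i r) = p"
        using q q' r by simp_all
      ultimately show ?thesis by (simp add: r)
    qed
    obtain i where "0 < p i" using False by auto
    then obtain q where q: "p = step i q" by (rule step_down)
    have straight: "?I (D i) (f p - f q) = ?I (D i) (f (step i p) - f p)"
    proof (cases "\<exists>j. j \<noteq> i \<and> 0 < p j")
      case True
      then obtain j where j: "j \<noteq> i" "0 < p j" by blast
      from j(2) obtain q' where q': "p = step j q'" by (rule step_down)
      show ?thesis
        using backward[OF q q'] forward[OF q' down(1)[OF q]] j(1) by simp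
    next
      case False
      then have "q d = 0" if "d \<noteq> i" for d
        using that q by (auto simp: step_def)
      from axis[of i q, OF this] show ?thesis by (simp add: q)
    qed
    have "?I d e = ?I (D i) (f p - f q)" if "(d, e) \<in> edges S p" for d e
    proof -
      from that obtain j where j: "d = D j" "j \<in> S"
        and e: "e = f (step j p) - f p \<or> (\<exists>q'. p = step j q' \<and> e = f p - f q')"
        by (auto simp: edges_def)
      from e show ?thesis
      proof
        assume "e = f (step j p) - f p"
        then show ?thesis
          using straight forward[OF q j(2)] j(1) by (cases "j = i") auto
      next
        assume "\<exists>q'. p = step j q' \<and> e = f p - f q'"
        then show ?thesis using backward[OF q] j(1) by auto
      qed
    qed
    then show ?thesis unfolding balanced_def by auto
  qed
qed

text \<open>Every step in direction \<open>j\<close> can be replaced by a step in direction \<open>i\<close>, so moving the coordinate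
  \<open>p j\<close> over to \<open>i\<close> changes neither \<open>f p\<close> nor the parity of the level, and loses no edge.\<close>

lemma balanced_merge:
  assumes ij: "i \<in> S" "i \<noteq> j" "D i = D j"
    and coincide: "\<And>p. f (step i p) = f (step j p)"
    and less: "\<And>p. (\<And>d. d \<notin> S - {j} \<Longrightarrow> p d = 0) \<Longrightarrow> balanced (S - {j}) p"
    and supp: "\<And>d. d \<notin> S \<Longrightarrow> p d = 0"
  shows "balanced S p"
proof -
  define dir where "dir d = (if d = j then i else d)" for d
  define merge where "merge p = p(i := p i + p j, j := 0)" for p :: "'d \<Rightarrow> nat"
  have merge_step: "merge (step d p) = step (dir d) (merge p)" for d p
    using ij(2) by (auto simp: merge_def step_def dir_def fun_eq_iff)
  have f_dir: "f (step (dir d) p) = f (step d p)" for d p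
    using coincide by (simp add: dir_def)
  have f_merge: "f (merge p) = f p" for p
  proof (induction "p j" arbitrary: p)
    case 0
    then have "merge p = p" by (auto simp: merge_def fun_eq_iff)
    then show ?case by simp
  next
    case (Suc n)
    then obtain q where q: "p = step j q" by (metis step_down zero_less_Suc)
    have "n = step i q j" using Suc.hyps(2) q ij(2) by (simp add: step_def)
    moreover have "merge p = merge (step i q)"
      using ij(2) q by (auto simp: merge_def step_def fun_eq_iff)
    ultimately show ?case using Suc.hyps(1)[of "step i q"] q coincide by simp
  qed
  have level_merge: "level (merge p) = level p" for p
  proof (induction p rule: step_induct)
    case zero
    have "merge (\<lambda>_. 0) = (\<lambda>_. 0)" by (auto simp: merge_def fun_eq_iff)
    then show ?case by simp
  next
    case (step d q)
    then show ?case by (simp add: merge_step)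
  qed
  have "edges S p \<subseteq> edges (S - {j}) (merge p)"
  proof
    fix x assume "x \<in> edges S p"
    then obtain d e where x: "x = (D d, e)" and d: "d \<in> S"
      and e: "e = f (step d p) - f p \<or> (\<exists>q. p = step d q \<and> e = f p - f q)"
      by (auto simp: edges_def)
    have dir: "dir d \<in> S - {j}" "D (dir d) = D d" using d ij by (auto simp: dir_def)
    have fwd: "f (step d q) = f (step (dir d) (merge q))" for q
      by (metis f_merge merge_step)
    have "e = f (step (dir d) (merge p)) - f (merge p) \<or>
          (\<exists>q. merge p = step (dir d) q \<and> e = f (merge p) - f q)"
      using e by (metis f_merge fwd merge_step)
    then show "x \<in> edges (S - {j}) (merge p)"
      using x dir unfolding edges_def by (auto intro!: exI[of _ "dir d"])
  qed
  moreover have "balanced (S - {j}) (merge p)"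
    using supp ij by (intro less) (auto simp: merge_def)
  ultimately show ?thesis
    unfolding balanced_def level_merge by blast
qed

text \<open>Directions are merged until no two of them coincide throughout; the remaining set of
  directions satisfies the hypothesis of \<open>balanced_generic\<close> by \<open>plane_dichotomy\<close>.\<close>

lemma balanced_region:
  fixes S :: "'d set"
  assumes "\<And>d. d \<notin> S \<Longrightarrow> p d = 0"
  shows "balanced S p"
  using finite[of S] assms
proof (induction S arbitrary: p rule: finite_psubset_induct)
  case (psubset S)
  show ?case
  proof (cases "\<exists>i\<in>S. \<exists>j\<in>S. i \<noteq> j \<and> D i = D j \<and> (\<forall>p. f (step i p) = f (step j p))")
    case True
    then obtain i j where ij: "i \<in> S" "j \<in> S" "i \<noteq> j" "D i = D j"
      and eq: "\<And>p. f (step i p) = f (step j p)" by blast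
    show ?thesis
      using psubset.IH[of "S - {j}"] psubset.prems ij(2)
      by (intro balanced_merge[OF ij(1,3,4) eq]) auto
  next
    case False
    show ?thesis
    proof (rule balanced_generic)
      show "D i \<noteq> D j \<or> (\<forall>p. f (step i (step j p)) = f p)"
        if "i \<in> S" "j \<in> S" "i \<noteq> j" for i j
        using plane_dichotomy[OF that(3)] False that by metis
    qed (rule psubset.prems)
  qed
qed

theorem neighbours_equidistant:
  assumes "even (level p)"
    and "u = f (step i p) \<or> (\<exists>q. p = step i q \<and> u = f q)"
    and "v = f (step j p) \<or> (\<exists>q. p = step j q \<and> v = f q)"
  shows "dist (f p) u = dist (f p) v"
proof -
  have edge: "\<exists>e. (D i, e) \<in> edges UNIV p \<and> norm e = dist (f p) u"
    if "u = f (step i p) \<or> (\<exists>q. p = step i q \<and> u = f q)" for i u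
  proof -
    from that show ?thesis
    proof
      assume "u = f (step i p)"
      then show ?thesis
        using forward_edge[of i UNIV p] by (intro exI[of _ "u - f p"]) (simp add: dist_norm norm_minus_commute)
    next
      assume "\<exists>q. p = step i q \<and> u = f q"
      then obtain q where "p = step i q" "u = f q" by blast
      then show ?thesis
        using backward_edge[of i UNIV q] by (intro exI[of _ "f p - u"]) (simp add: dist_norm)
    qed
  qed
  from edge[OF assms(2)] obtain e where e: "(D i, e) \<in> edges UNIV p" "norm e = dist (f p) u" by blast
  from edge[OF assms(3)] obtain e' where e': "(D j, e') \<in> edges UNIV p" "norm e' = dist (f p) v" by blast
  have "balanced UNIV p" by (rule balanced_region) simp
  from balancedD[OF this e(1) e'(1)] show ?thesis
    using assms(1) e(2) e'(2) by (simp add: edge_invariant_def)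
qed

end

section \<open>The constraint on a coordinate axis\<close>

text \<open>With \<open>r n = x (n + 1) - x n\<close>, the recursion amounts to the invariant
  \<open>c * x (2 * k) = 2 * k * r (2 * k)\<close>, which holds for \<open>k = 0\<close> because \<open>x 0 = 0\<close>.  It makes the
  recursion at \<open>2 * k + 1\<close> a linear relation between \<open>r (2 * k)\<close> and \<open>r (2 * k + 1)\<close>, and this relation
  gives \<open>c * x (2 * k + 2) = (2 * k + 2) * r (2 * k + 1)\<close>.  The recursion at \<open>2 * k + 2\<close> then reduces to
  \<open>r (2 * k + 2) = r (2 * k + 1)\<close>, which restores the invariant.\<close>

lemma axis_recursion:
  fixes x :: "nat \<Rightarrow> complex" and c :: complex
  assumes "x 0 = 0" and distinct: "\<And>n. x (Suc n) \<noteq> x n"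
    and rec: "\<And>n. c * x (Suc n) * (x (Suc (Suc n)) - x n) =
      2 * of_nat (Suc n) * (x (Suc (Suc n)) - x (Suc n)) * (x (Suc n) - x n)"
  shows "(2 * of_nat k + 2 - c) * (x (2 * k + 2) - x (2 * k + 1)) =
         (2 * of_nat k + c) * (x (2 * k + 1) - x (2 * k))"
    and "x (2 * k + 3) - x (2 * k + 2) = x (2 * k + 2) - x (2 * k + 1)"
proof -
  define r where "r n = x (Suc n) - x n" for n
  have r: "r n \<noteq> 0" for n using distinct by (simp add: r_def)
  have rec': "c * x (Suc n) * (r n + r (Suc n)) = 2 * of_nat (Suc n) * r (Suc n) * r n" for n
    using rec[of n] by (simp add: r_def)
  have odd: "(2 * of_nat k + 2 - c) * r (Suc (2 * k)) = (2 * of_nat k + c) * r (2 * k)"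
    if k: "c * x (2 * k) = 2 * of_nat k * r (2 * k)" for k
  proof -
    have "c * x (Suc (2 * k)) = (2 * of_nat k + c) * r (2 * k)"
      using k by (simp add: r_def algebra_simps)
    then have "r (2 * k) * ((2 * of_nat k + c) * (r (2 * k) + r (Suc (2 * k)))) =
      r (2 * k) * (2 * of_nat (Suc (2 * k)) * r (Suc (2 * k)))"
      using rec'[of "2 * k"] by (simp add: algebra_simps)
    then have "(2 * of_nat k + c) * (r (2 * k) + r (Suc (2 * k))) =
      2 * of_nat (Suc (2 * k)) * r (Suc (2 * k))" using r by simp
    then show ?thesis by (simp add: algebra_simps)
  qed
  have step: "c * x (2 * k + 2) = 2 * of_nat (Suc k) * r (2 * k + 1)"
             "r (2 * k + 2) = r (2 * k + 1)"
    if k: "c * x (2 * k) = 2 * of_nat k * r (2 * k)" for k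
  proof -
    have "c * x (2 * k + 2) = c * x (2 * k) + c * r (2 * k) + c * r (2 * k + 1)"
      by (simp add: r_def algebra_simps)
    then show e: "c * x (2 * k + 2) = 2 * of_nat (Suc k) * r (2 * k + 1)"
      using odd[OF k] k by (simp add: algebra_simps)
    have "c * x (2 * k + 2) * (r (2 * k + 1) + r (2 * k + 2)) =
      (2 * of_nat (Suc k) * r (2 * k + 1)) * (2 * r (2 * k + 2))"
      using rec'[of "2 * k + 1"] by (simp add: algebra_simps)
    then have "(2 * of_nat (Suc k) * r (2 * k + 1)) * (r (2 * k + 1) + r (2 * k + 2)) =
      (2 * of_nat (Suc k) * r (2 * k + 1)) * (2 * r (2 * k + 2))"
      unfolding e .
    then have "r (2 * k + 1) + r (2 * k + 2) = 2 * r (2 * k + 2)"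
      using r[of "2 * k + 1"]
      by (metis mult_cancel_left mult_eq_0_iff nat.distinct(1) of_nat_eq_0_iff zero_neq_numeral)
    then show "r (2 * k + 2) = r (2 * k + 1)" by simp
  qed
  have even: "c * x (2 * k) = 2 * of_nat k * r (2 * k)" for k
  proof (induction k)
    case 0
    show ?case using \<open>x 0 = 0\<close> by simp
  next
    case (Suc k)
    show ?case using step[OF Suc] by simp
  qed
  show "(2 * of_nat k + 2 - c) * (x (2 * k + 2) - x (2 * k + 1)) =
        (2 * of_nat k + c) * (x (2 * k + 1) - x (2 * k))"
    using odd[OF even[of k]] by (simp add: r_def)
  show "x (2 * k + 3) - x (2 * k + 2) = x (2 * k + 2) - x (2 * k + 1)"
    using step(2)[OF even[of k]] by (simp add: r_def numeral_3_eq_3)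
qed

text \<open>The invariants belong to the vertex \<open>x (n + 1)\<close>, which is a centre if \<open>n\<close> is odd.  If \<open>n\<close> is even,
  the two edges at it have a real quotient because \<open>c\<close> is real.\<close>

lemma axis_edge_invariant:
  fixes x :: "nat \<Rightarrow> complex" and c d :: complex
  assumes x: "x 0 = 0" "\<And>n. x (Suc n) \<noteq> x n"
    and rec: "\<And>n. c * x (Suc n) * (x (Suc (Suc n)) - x n) =
      2 * of_nat (Suc n) * (x (Suc (Suc n)) - x (Suc n)) * (x (Suc n) - x n)"
    and "c \<in> \<real>" and "d \<noteq> 0"
  shows "edge_invariant (odd n) d (x (Suc (Suc n)) - x (Suc n)) = edge_invariant (odd n) d (x (Suc n) - x n)"
proof (cases "odd n")
  case True
  then obtain k where "n = 2 * k + 1" by (elim oddE)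
  then show ?thesis
    using axis_recursion(2)[OF x rec, where k = k] by (simp add: numeral_3_eq_3)
next
  case False
  then obtain k where n: "n = 2 * k" by (auto elim: evenE)
  define r s where "r = x (Suc n) - x n" and "s = x (Suc (Suc n)) - x (Suc n)"
  have nz: "r \<noteq> 0" "s \<noteq> 0" using x(2) by (auto simp: r_def s_def)
  from \<open>c \<in> \<real>\<close> obtain c' where c: "c = of_real c'" by (auto elim: Reals_cases)
  have rs: "of_real (2 * real k + 2 - c') * s = of_real (2 * real k + c') * r"
    using axis_recursion(1)[OF x rec, where k = k] by (simp add: n c r_def s_def)
  have ne: "2 * real k + 2 - c' \<noteq> 0"
  proof
    assume zero: "2 * real k + 2 - c' = 0"
    with rs nz have "2 * real k + c' = 0" by (metis mult_zero_left mult_eq_0_iff of_real_0 of_real_eq_0_iff)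
    \<comment> \<open>The two coefficients have the sum \<open>4 * k + 2\<close>.\<close>
    with zero show False by linarith
  qed
  define t where "t = (2 * real k + c') / (2 * real k + 2 - c')"
  have "s = of_real (2 * real k + c') * r / of_real (2 * real k + 2 - c')"
    using rs ne by (metis nonzero_mult_div_cancel_left of_real_eq_0_iff)
  then have s: "s = of_real t * r"
    by (simp add: t_def)
  have t: "t \<noteq> 0" using s nz by auto
  show ?thesis
    using False nz s t \<open>d \<noteq> 0\<close> by (simp add: edge_invariant_def flip: r_def s_def)
qed

section \<open>Circle patterns in the octant\<close>

lemma cross_ratio_cleared:
  assumes "cross_ratio z1 z2 z3 z4 = d1 / d2" "d1 \<noteq> 0" "d2 \<noteq> 0"
  shows "(z2 - z1) * (z4 - z3) * d2 = d1 * ((z3 - z2) * (z1 - z4))"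
    and "z1 \<noteq> z2" "z2 \<noteq> z3" "z3 \<noteq> z4" "z4 \<noteq> z1"
proof -
  have "(z3 - z2) * (z1 - z4) \<noteq> 0" "(z2 - z1) * (z4 - z3) \<noteq> 0"
    using assms by (auto simp: cross_ratio_def)
  then show "(z2 - z1) * (z4 - z3) * d2 = d1 * ((z3 - z2) * (z1 - z4))"
    and "z1 \<noteq> z2" "z2 \<noteq> z3" "z3 \<noteq> z4" "z4 \<noteq> z1"
    using assms by (auto simp: cross_ratio_def field_simps)
qed

definition octant_point :: "(3 \<Rightarrow> nat) \<Rightarrow> int \<times> int \<times> int" where
  "octant_point p = (int (p 1), int (p 2), - int (p 3))"

lemma octant_point_step:
  "octant_point (step 1 p) = (int (p 1) + 1, int (p 2), - int (p 3))"
  "octant_point (step 2 p) = (int (p 1), int (p 2) + 1, - int (p 3))"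
  "octant_point (step 3 p) = (int (p 1), int (p 2), - int (p 3) - 1)"
  by (simp_all add: octant_point_def step_def)

lemma step_apply:
  "step i p j = (if i = j then Suc (p j) else p j)"
  by (simp add: step_def)

lemma octant_neighbours:
  assumes u: "u \<in> lattice_neighbours k l m \<inter> Q" and p: "octant_point p = (k, l, m)"
  shows "\<exists>i. u = octant_point (step i p) \<or> (\<exists>q. p = step i q \<and> u = octant_point q)"
proof -
  have klm: "int (p 1) = k" "int (p 2) = l" "- int (p 3) = m"
    using p by (simp_all add: octant_point_def)
  have forward: "octant_point (step 1 p) = (k+1, l, m)" "octant_point (step 2 p) = (k, l+1, m)"
    "octant_point (step 3 p) = (k, l, m-1)"
    by (simp_all only: octant_point_step klm)
  from u consider "u = (k+1, l, m)" | "u = (k-1, l, m)" "0 < k" | "u = (k, l+1, m)"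
    | "u = (k, l-1, m)" "0 < l" | "u = (k, l, m-1)" | "u = (k, l, m+1)" "m < 0"
    by (auto simp: lattice_neighbours_def Q_def)
  then show ?thesis
  proof cases
    case 2
    then have "0 < p 1" using klm by linarith
    then obtain q where q: "p = step 1 q" by (rule step_down)
    then have "octant_point q = (k-1, l, m)" using klm by (auto simp: octant_point_def step_apply)
    then show ?thesis using q 2 by metis
  next
    case 4
    then have "0 < p 2" using klm by linarith
    then obtain q where q: "p = step 2 q" by (rule step_down)
    then have "octant_point q = (k, l-1, m)" using klm by (auto simp: octant_point_def step_apply)
    then show ?thesis using q 4 by metis
  next
    case 6
    then have "0 < p 3" using klm by linarith
    then obtain q where q: "p = step 3 q" by (rule step_down)
    then have "octant_point q = (k, l, m+1)" using klm by (auto simp: octant_point_def step_apply)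
    then show ?thesis using q 6 by metis
  qed (metis forward)+
qed

lemma level_3: "level (p :: 3 \<Rightarrow> nat) = p 1 + p 2 + p 3"
  unfolding level_def by (rule sum_3)

lemma constraint_term_reverse: "constraint_term (- n) x y w = constraint_term n w y x"
proof -
  have "(w - y) * (y - x) = (x - y) * (y - w)" "w - x = - (x - w)"
    by (simp_all add: algebra_simps)
  then have "((w - y) * (y - x)) / (w - x) = - (((x - y) * (y - w)) / (x - w))"
    by (simp only: minus_divide_right)
  then show ?thesis by (simp add: constraint_term_def)
qed

lemma constraint_term_0 [simp]: "constraint_term 0 x y w = 0"
  by (simp add: constraint_term_def)

lemma constraint_term_cleared:
  assumes "c * y = constraint_term n x y w" "w \<noteq> x"
  shows "c * y * (w - x) = 2 * of_int n * (w - y) * (y - x)"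
  using assms by (simp add: constraint_term_def)

theorem theorem8p5:
  fixes z :: "int \<times> int \<times> int \<Rightarrow> complex"
    and c \<Delta>1 \<Delta>2 \<Delta>3 :: complex
    and \<alpha>1 \<alpha>2 \<alpha>3 \<beta> \<gamma> :: real
  assumes "c \<noteq> 0" and "c \<in> \<real>"
    and "cross_ratio_system \<Delta>1 \<Delta>2 \<Delta>3 z"
    and "\<Delta>3 / \<Delta>2 = exp (- 2 * \<i> * of_real \<alpha>1)"
    and "\<Delta>1 / \<Delta>3 = exp (- 2 * \<i> * of_real \<alpha>2)"
    and "\<Delta>2 / \<Delta>1 = exp (- 2 * \<i> * of_real \<alpha>3)"
    and "satisfies_constraint c z"
    and "z (1, 0, 0) = 1"
    and "z (0, 1, 0) = exp (\<i> * of_real \<beta>)"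
    and "z (0, 0, -1) = exp (\<i> * of_real \<gamma>)"
  shows "\<forall>k l m. (k, l, m) \<in> Q \<and> even (k + l + m) \<longrightarrow>
    (\<exists>r>0. \<forall>p \<in> lattice_neighbours k l m \<inter> Q. z p \<in> sphere (z (k, l, m)) r)"
proof -
  define D :: "3 \<Rightarrow> complex" where "D i = (if i = 1 then \<Delta>1 else if i = 2 then \<Delta>2 else \<Delta>3)" for i
  define f where "f p = z (octant_point p)" for p
  have D: "D 1 = \<Delta>1" "D 2 = \<Delta>2" "D 3 = \<Delta>3" by (simp_all add: D_def)
  have nz: "\<Delta>1 \<noteq> 0" "\<Delta>2 \<noteq> 0" "\<Delta>3 \<noteq> 0"
    using assms(4-6) by (metis div_0 div_by_0 exp_not_eq_zero)+
  have "norm (\<Delta>3 / \<Delta>2) = 1" "norm (\<Delta>1 / \<Delta>3) = 1"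
    unfolding assms(4,5) by (simp_all add: norm_exp_eq_Re)
  then have norms: "norm \<Delta>1 = norm \<Delta>3" "norm \<Delta>2 = norm \<Delta>3"
    using nz by (simp_all add: norm_divide)

  \<comment> \<open>The three families of quadrilaterals are listed from different corners; clearing denominators
    brings them to the common form with base point \<open>p\<close>.\<close>
  have cr13: "cross_ratio (f p) (f (step 1 p)) (f (step 1 (step 3 p))) (f (step 3 p)) = \<Delta>1 / \<Delta>3"
    and cr32: "cross_ratio (f (step 2 (step 3 p))) (f (step 2 p)) (f p) (f (step 3 p)) = \<Delta>3 / \<Delta>2"
    and cr21: "cross_ratio (f (step 1 p)) (f (step 1 (step 2 p))) (f (step 2 p)) (f p) = \<Delta>2 / \<Delta>1"
    for p
  proof -
    let ?k = "int (p 1)" and ?l = "int (p 2)" and ?m = "- int (p 3)"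
    have pts: "octant_point p = (?k, ?l, ?m)"
      "octant_point (step 1 p) = (?k+1, ?l, ?m)" "octant_point (step 2 p) = (?k, ?l+1, ?m)"
      "octant_point (step 3 p) = (?k, ?l, ?m-1)" "octant_point (step 1 (step 2 p)) = (?k+1, ?l+1, ?m)"
      "octant_point (step 1 (step 3 p)) = (?k+1, ?l, ?m-1)"
      "octant_point (step 2 (step 3 p)) = (?k, ?l+1, ?m-1)"
      by (simp_all add: octant_point_def step_apply)
    note cr = assms(3)[unfolded cross_ratio_system_def]
    have "{(?k, ?l, ?m), (?k+1, ?l, ?m), (?k+1, ?l, ?m-1), (?k, ?l, ?m-1)} \<subseteq> Q"
      by (auto simp: Q_def)
    from cr[THEN conjunct1, rule_format, OF this]
    show "cross_ratio (f p) (f (step 1 p)) (f (step 1 (step 3 p))) (f (step 3 p)) = \<Delta>1 / \<Delta>3"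
      by (simp add: f_def pts)
    have "{(?k, ?l+1, ?m-1), (?k, ?l+1, ?m-1+1), (?k, ?l+1-1, ?m-1+1), (?k, ?l+1-1, ?m-1)} \<subseteq> Q"
      by (auto simp: Q_def)
    from cr[THEN conjunct2, THEN conjunct1, rule_format, OF this]
    show "cross_ratio (f (step 2 (step 3 p))) (f (step 2 p)) (f p) (f (step 3 p)) = \<Delta>3 / \<Delta>2"
      by (simp add: f_def pts)
    have "{(?k+1, ?l, ?m), (?k+1, ?l+1, ?m), (?k+1-1, ?l+1, ?m), (?k+1-1, ?l, ?m)} \<subseteq> Q"
      by (auto simp: Q_def)
    from cr[THEN conjunct2, THEN conjunct2, rule_format, OF this]
    show "cross_ratio (f (step 1 p)) (f (step 1 (step 2 p))) (f (step 2 p)) (f p) = \<Delta>2 / \<Delta>1"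
      by (simp add: f_def pts)
  qed
  note cr13' = cross_ratio_cleared[OF cr13 nz(1,3)]
    and cr32' = cross_ratio_cleared[OF cr32 nz(3,2)]
    and cr21' = cross_ratio_cleared[OF cr21 nz(2,1)]

  have constraint:
    "(p 1 \<noteq> 0 \<longrightarrow> f (step 1 p) \<noteq> z (int (p 1) - 1, int (p 2), - int (p 3))) \<and>
     (p 2 \<noteq> 0 \<longrightarrow> f (step 2 p) \<noteq> z (int (p 1), int (p 2) - 1, - int (p 3))) \<and>
     (p 3 \<noteq> 0 \<longrightarrow> z (int (p 1), int (p 2), - int (p 3) + 1) \<noteq> f (step 3 p)) \<and>
     c * f p = constraint_term (int (p 1)) (z (int (p 1) - 1, int (p 2), - int (p 3))) (f p) (f (step 1 p))
       + constraint_term (int (p 2)) (z (int (p 1), int (p 2) - 1, - int (p 3))) (f p) (f (step 2 p))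
       + constraint_term (int (p 3)) (z (int (p 1), int (p 2), - int (p 3) + 1)) (f p) (f (step 3 p))" for p
  proof -
    have "(int (p 1), int (p 2), - int (p 3)) \<in> Q" by (simp add: Q_def)
    from assms(7)[unfolded satisfies_constraint_def, rule_format, OF this]
    show ?thesis
      unfolding f_def octant_point_step
      by (simp add: octant_point_def constraint_term_reverse)
  qed
  have distinct: "f (step i (step i p)) \<noteq> f p" for i p
    using constraint[of "step i p"] exhaust_3[of i]
    by (auto simp: step_apply f_def[of p] octant_point_def)
  have origin: "f (\<lambda>_. 0) = 0"
    using constraint[of "\<lambda>_. 0"] \<open>c \<noteq> 0\<close> by simp
  have rec: "c * f (step i p) * (f (step i (step i p)) - f p) =
      2 * of_nat (Suc (p i)) * (f (step i (step i p)) - f (step i p)) * (f (step i p) - f p)"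
    if "\<And>d. d \<noteq> i \<Longrightarrow> p d = 0" for i p
  proof -
    have "c * f (step i p) = constraint_term (int (Suc (p i))) (f p) (f (step i p)) (f (step i (step i p)))"
      using constraint[of "step i p"] exhaust_3[of i] that
      by (auto simp: step_apply f_def[of p] octant_point_def)
    from constraint_term_cleared[OF this distinct] show ?thesis by simp
  qed

  interpret cross_ratio_lattice_axes D f
  proof
    show "D i \<noteq> 0" for i using nz by (simp add: D_def)
    show "norm (D i) = norm (D j)" for i j using norms by (simp add: D_def)
    show edge: "f (step i p) \<noteq> f p" for i p
      using exhaust_3[of i] cr13'(2)[of p] cr13'(5)[of p] cr21'(4)[of p] by auto
    show "f (step i (step i p)) \<noteq> f p" for i p by (rule distinct)
    show "(f (step i p) - f p) * (f (step i (step j p)) - f (step j p)) * D j =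
      D i * (f (step i (step j p)) - f (step i p)) * (f (step j p) - f p)" if "i \<noteq> j" for i j p
    proof -
      let ?E = "\<lambda>i j. (f (step i p) - f p) * (f (step i (step j p)) - f (step j p)) * D j =
        D i * (f (step i (step j p)) - f (step i p)) * (f (step j p) - f p)"
      have E: "?E 1 2" "?E 1 3" "?E 2 3"
        unfolding D using cr21'(1)[of p] cr13'(1)[of p] cr32'(1)[of p] by algebra+
      have swap: "?E j i" if "?E i j" for i j
        using that by (simp add: step_commute[of j i] mult_ac)
      have "i = 1 \<and> j = 2 \<or> i = 1 \<and> j = 3 \<or> i = 2 \<and> j = 3 \<or>
            i = 2 \<and> j = 1 \<or> i = 3 \<and> j = 1 \<or> i = 3 \<and> j = 2"
        using \<open>i \<noteq> j\<close> exhaust_3[of i] exhaust_3[of j] by auto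
      then show ?thesis
        using E E[THEN swap] by (elim disjE conjE; simp only:)
    qed
    have "norm (f (step i (\<lambda>_. 0)) - f (\<lambda>_. 0)) = 1" for i
      using exhaust_3[of i] assms(8-10) unfolding origin
      by (auto simp: f_def octant_point_def step_apply)
    then show "norm (f (step i (\<lambda>_. 0)) - f (\<lambda>_. 0)) = norm (f (step j (\<lambda>_. 0)) - f (\<lambda>_. 0))" for i j
      by simp
    show "edge_invariant (odd (level p)) (D i) (f (step i (step i p)) - f (step i p)) =
      edge_invariant (odd (level p)) (D i) (f (step i p) - f p)"
      if ax: "\<And>d. d \<noteq> i \<Longrightarrow> p d = 0" for i p
    proof -
      \<comment> \<open>The point \<open>p\<close> lies on the axis of \<open>i\<close>, so \<open>f\<close> becomes a sequence along this axis.\<close>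
      define pt where "pt n = (\<lambda>_. 0)(i := n)" for n :: nat
      have pt: "pt (Suc n) = step i (pt n)" for n by (simp add: pt_def step_def)
      have p: "p = pt (p i)" using ax by (auto simp: pt_def)
      have "level (pt n) = n" for n
        by (induction n) (simp_all add: pt, simp add: pt_def level_def)
      then have level: "level p = p i" using p by metis
      have "edge_invariant (odd (p i)) (D i) (f (pt (Suc (Suc (p i)))) - f (pt (Suc (p i)))) =
        edge_invariant (odd (p i)) (D i) (f (pt (Suc (p i))) - f (pt (p i)))"
      proof (rule axis_edge_invariant[where c = c])
        show "f (pt 0) = 0" using origin by (simp add: pt_def fun_upd_idem)
        show "f (pt (Suc n)) \<noteq> f (pt n)" for n using edge by (simp add: pt)
        show "c * f (pt (Suc n)) * (f (pt (Suc (Suc n))) - f (pt n)) =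
          2 * of_nat (Suc n) * (f (pt (Suc (Suc n))) - f (pt (Suc n))) * (f (pt (Suc n)) - f (pt n))" for n
          using rec[of i "pt n"] by (simp add: pt) (simp add: pt_def)
        show "c \<in> \<real>" by fact
        show "D i \<noteq> 0" using nz by (simp add: D_def)
      qed
      then show ?thesis by (simp add: level pt flip: p)
    qed
  qed

  show ?thesis
  proof (intro allI impI)
    fix k l m :: int
    assume klm: "(k, l, m) \<in> Q \<and> even (k + l + m)"
    define p :: "3 \<Rightarrow> nat" where "p i = (if i = 1 then nat k else if i = 2 then nat l else nat (- m))" for i
    have sgn: "0 \<le> k" "0 \<le> l" "m \<le> 0" using klm by (auto simp: Q_def)
    have p: "octant_point p = (k, l, m)" using sgn by (simp add: octant_point_def p_def)
    have "even (int (level p))"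
      using klm sgn by (simp add: level_3 p_def)
    then have even: "even (level p)" by simp
    have fp: "f p = z (k, l, m)" by (simp add: f_def p)
    let ?r = "dist (f p) (f (step 1 p))"
    have "?r > 0" using edge_nonzero[of 1 p] by auto
    moreover have "z u \<in> sphere (z (k, l, m)) ?r" if u: "u \<in> lattice_neighbours k l m \<inter> Q" for u
    proof -
      obtain i where "u = octant_point (step i p) \<or> (\<exists>q. p = step i q \<and> u = octant_point q)"
        using octant_neighbours[OF u p] ..
      then have "z u = f (step i p) \<or> (\<exists>q. p = step i q \<and> z u = f q)"
        unfolding f_def by blast
      then have "dist (f p) (z u) = ?r"
        by (rule neighbours_equidistant[OF even, where j = 1]) simp
      then show ?thesis by (simp add: fp)
    qed
    ultimately show "\<exists>r>0. \<forall>p \<in> lattice_neighbours k l m \<inter> Q. z p \<in> sphere (z (k, l, m)) r"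
      by blast
  qed
qed

end
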